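(* Let $\mathbb{K}$ be $\mathbb{R}$, $\mathbb{C}$, or the quaternions $\mathbb{H}$. For all positive integers $m,n$ there exist left and right general-diagonal scale functions $\mathcal{D}_U^L,\mathcal{D}_U^R$ on the set of all $m\times n$ matrices over $\mathbb{K}$ such that the operator $$A^{-U}:=\mathcal{D}_U^R[A]\cdot\left(\mathcal{D}_U^L[A]\cdot A\cdot\mathcal{D}_U^R[A]\right)^{+}\cdot\mathcal{D}_U^L[A],$$ where $(\cdot)^{+}$ is the Moore-Penrose inverse, satisfies, for every $m\times n$ matrix $A$ over $\mathbb{K}$ and all nonsingular diagonal matrices $D$ ($m\times m$) and $E$ ($n\times n$) over $\mathbb{K}$: $$A\,A^{-U}A=A,\qquad A^{-U}A\,A^{-U}=A^{-U},\qquad (DAE)^{-U}=E^{-1}A^{-U}D^{-1},\qquad \operatorname{rank}[A^{-U}]=\operatorname{rank}[A].$$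
   Context: A positive diagonal matrix is a diagonal matrix whose diagonal entries are strictly positive reals. A unitary diagonal matrix is a diagonal matrix over $\mathbb{K}$ whose diagonal entries have magnitude $1$. Left and right general-diagonal scale functions on the set of $m\times n$ matrices are functions assigning to each $m\times n$ matrix $A$ an $m\times m$ positive diagonal matrix $\mathcal{D}_U^L[A]$ and an $n\times n$ positive diagonal matrix $\mathcal{D}_U^R[A]$ that jointly satisfy, for all conformant positive diagonal matrices $D_+,E_+$, unitary diagonal matrices $D_u,D_v$, and permutation matrices $P,Q$: (1) $\mathcal{D}_U^L[D_+AE_+]\cdot(D_+AE_+)\cdot\mathcal{D}_U^R[D_+AE_+]=\mathcal{D}_U^L[A]\cdot A\cdot\mathcal{D}_U^R[A]$; (2) $\mathcal{D}_U^L[PAQ]\cdot(PAQ)\cdot\mathcal{D}_U^R[PAQ]=P\cdot\{\mathcal{D}_U^L[A]\cdot A\cdot\mathcal{D}_U^R[A]\}\cdot Q$; (3) $\mathcal{D}_U^L[D_uAD_v]=\mathcal{D}_U^L[A]$; (4) $\mathcal{D}_U^R[D_uAD_v]=\mathcal{D}_U^R[A]$. *)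

theory Defs
  imports "HOL-Analysis.Analysis"
begin

section \<open>Quaternions\<close>

text \<open>The quaternion \<open>a + b i + c j + d k\<close> is \<open>Quat a b c d\<close>.\<close>

datatype quat = Quat (QRe: real) (QI: real) (QJ: real) (QK: real)

lemma quat_eq_iff:
  "x = y \<longleftrightarrow> QRe x = QRe y \<and> QI x = QI y \<and> QJ x = QJ y \<and> QK x = QK y"
  by (cases x; cases y) auto

instantiation quat :: ab_group_add
begin

definition "0 = Quat 0 0 0 0"
definition "x + y = Quat (QRe x + QRe y) (QI x + QI y) (QJ x + QJ y) (QK x + QK y)"
definition "- x = Quat (- QRe x) (- QI x) (- QJ x) (- QK x)"
definition "x - y = Quat (QRe x - QRe y) (QI x - QI y) (QJ x - QJ y) (QK x - QK y)"

instance
  by standard (simp_all add: quat_eq_iff zero_quat_def plus_quat_def uminus_quat_def minus_quat_def)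

end

instantiation quat :: real_algebra_1
begin

definition "1 = Quat 1 0 0 0"

definition "x * y = Quat
  (QRe x * QRe y - QI x * QI y - QJ x * QJ y - QK x * QK y)
  (QRe x * QI y + QI x * QRe y + QJ x * QK y - QK x * QJ y)
  (QRe x * QJ y - QI x * QK y + QJ x * QRe y + QK x * QI y)
  (QRe x * QK y + QI x * QJ y - QJ x * QI y + QK x * QRe y)"

definition "r *\<^sub>R x = Quat (r * QRe x) (r * QI x) (r * QJ x) (r * QK x)"

instance
  by standard
    (simp_all add: quat_eq_iff zero_quat_def one_quat_def plus_quat_def times_quat_def
      scaleR_quat_def algebra_simps)

end

lemma quat_sel [simp]:
  "QRe 0 = 0" "QI 0 = 0" "QJ 0 = 0" "QK 0 = 0"
  "QRe 1 = 1" "QI 1 = 0" "QJ 1 = 0" "QK 1 = 0"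
  "QRe (x + y) = QRe x + QRe y" "QI (x + y) = QI x + QI y"
  "QJ (x + y) = QJ x + QJ y" "QK (x + y) = QK x + QK y"
  "QRe (- x) = - QRe x" "QI (- x) = - QI x" "QJ (- x) = - QJ x" "QK (- x) = - QK x"
  "QRe (x - y) = QRe x - QRe y" "QI (x - y) = QI x - QI y"
  "QJ (x - y) = QJ x - QJ y" "QK (x - y) = QK x - QK y"
  "QRe (r *\<^sub>R x) = r * QRe x" "QI (r *\<^sub>R x) = r * QI x"
  "QJ (r *\<^sub>R x) = r * QJ x" "QK (r *\<^sub>R x) = r * QK x"
  by (simp_all add: zero_quat_def one_quat_def plus_quat_def uminus_quat_def minus_quat_def
      scaleR_quat_def)

lemma quat_sel_mult:
  "QRe (x * y) = QRe x * QRe y - QI x * QI y - QJ x * QJ y - QK x * QK y"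
  "QI (x * y) = QRe x * QI y + QI x * QRe y + QJ x * QK y - QK x * QJ y"
  "QJ (x * y) = QRe x * QJ y - QI x * QK y + QJ x * QRe y + QK x * QI y"
  "QK (x * y) = QRe x * QK y + QI x * QJ y - QJ x * QI y + QK x * QRe y"
  by (simp_all add: times_quat_def)

lemma quat_sel_of_real [simp]:
  "QRe (of_real r) = r" "QI (of_real r) = 0" "QJ (of_real r) = 0" "QK (of_real r) = 0"
  by (simp_all add: of_real_def)

definition qcnj :: "quat \<Rightarrow> quat"
  where "qcnj x = Quat (QRe x) (- QI x) (- QJ x) (- QK x)"

lemma quat_sel_qcnj [simp]:
  "QRe (qcnj x) = QRe x" "QI (qcnj x) = - QI x" "QJ (qcnj x) = - QJ x" "QK (qcnj x) = - QK x"
  by (simp_all add: qcnj_def)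

definition qnorm2 :: "quat \<Rightarrow> real"
  where "qnorm2 x = (QRe x)\<^sup>2 + (QI x)\<^sup>2 + (QJ x)\<^sup>2 + (QK x)\<^sup>2"

lemma qnorm2_nonneg: "qnorm2 x \<ge> 0"
  by (simp add: qnorm2_def)

lemma qnorm2_eq_0_iff: "qnorm2 x = 0 \<longleftrightarrow> x = 0"
  by (auto simp: qnorm2_def quat_eq_iff add_nonneg_eq_0_iff)

lemma qnorm2_mult: "qnorm2 (x * y) = qnorm2 x * qnorm2 y"
  by (simp add: qnorm2_def quat_sel_mult power2_eq_square algebra_simps)

lemma mult_qcnj: "x * qcnj x = of_real (qnorm2 x)" "qcnj x * x = of_real (qnorm2 x)"
  by (simp_all add: quat_eq_iff quat_sel_mult qnorm2_def power2_eq_square algebra_simps)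

instantiation quat :: real_div_algebra
begin

definition inverse_quat :: "quat \<Rightarrow> quat"
  where "inverse x = inverse (qnorm2 x) *\<^sub>R qcnj x"

definition divide_quat :: "quat \<Rightarrow> quat \<Rightarrow> quat"
  where "x div y = x * inverse y" for x y :: quat

instance
proof
  fix x y :: quat
  show "x div y = x * inverse y"
    by (rule divide_quat_def)
  show "inverse (0 :: quat) = 0"
    by (simp add: inverse_quat_def qnorm2_eq_0_iff)
  assume "x \<noteq> 0"
  then have nz: "qnorm2 x \<noteq> 0"
    by (simp add: qnorm2_eq_0_iff)
  show "inverse x * x = 1"
    using nz by (simp add: inverse_quat_def mult_qcnj) (simp add: of_real_def)
  show "x * inverse x = 1"
    using nz by (simp add: inverse_quat_def mult_qcnj) (simp add: of_real_def)
qed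

end

instantiation quat :: real_normed_div_algebra
begin

definition norm_quat :: "quat \<Rightarrow> real"
  where "norm x = sqrt ((QRe x)\<^sup>2 + (QI x)\<^sup>2 + (QJ x)\<^sup>2 + (QK x)\<^sup>2)"

definition sgn_quat :: "quat \<Rightarrow> quat"
  where "sgn x = x /\<^sub>R norm x" for x :: quat

definition dist_quat :: "quat \<Rightarrow> quat \<Rightarrow> real"
  where "dist x y = norm (x - y)" for x y :: quat

definition uniformity_quat :: "(quat \<times> quat) filter"
  where "uniformity = (INF e\<in>{0<..}. principal {(x, y :: quat). dist x y < e})"

definition open_quat :: "quat set \<Rightarrow> bool"
  where "open U \<longleftrightarrow> (\<forall>x\<in>U. eventually (\<lambda>(x', y). x' = x \<longrightarrow> y \<in> U) uniformity)" for U :: "quat set"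

instance
proof
  fix x y :: quat and r :: real and U :: "quat set"
  have norm_tuple: "norm z = norm (QRe z, QI z, QJ z, QK z)" for z
    by (simp add: norm_quat_def norm_Pair add.assoc)
  have norm_qnorm2: "norm z = sqrt (qnorm2 z)" for z
    by (simp add: norm_quat_def qnorm2_def)
  show "sgn x = x /\<^sub>R norm x"
    by (rule sgn_quat_def)
  show "dist x y = norm (x - y)"
    by (rule dist_quat_def)
  show "uniformity = (INF e\<in>{0<..}. principal {(x, y :: quat). dist x y < e})"
    by (rule uniformity_quat_def)
  show "open U \<longleftrightarrow> (\<forall>x\<in>U. eventually (\<lambda>(x', y). x' = x \<longrightarrow> y \<in> U) uniformity)"
    by (rule open_quat_def)
  show "norm x = 0 \<longleftrightarrow> x = 0"
    by (simp add: norm_qnorm2 qnorm2_eq_0_iff)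
  show "norm (x + y) \<le> norm x + norm y"
    using norm_triangle_ineq[of "(QRe x, QI x, QJ x, QK x)" "(QRe y, QI y, QJ y, QK y)"]
    unfolding norm_tuple[of x] norm_tuple[of y] norm_tuple[of "x + y"] by simp
  show "norm (r *\<^sub>R x) = \<bar>r\<bar> * norm x"
  proof -
    have "qnorm2 (r *\<^sub>R x) = r\<^sup>2 * qnorm2 x"
      by (simp add: qnorm2_def power_mult_distrib algebra_simps)
    then show ?thesis
      by (simp add: norm_qnorm2 real_sqrt_mult)
  qed
  show "norm (x * y) = norm x * norm y"
    by (simp add: norm_qnorm2 qnorm2_mult real_sqrt_mult)
qed

end


section \<open>Conjugation\<close>

text \<open>
  The conjugate of a product is stated with reversed factors, as needed for the
  noncommutative quaternions.
\<close>

class conj_div_algebra = real_normed_div_algebra +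
  fixes kconj :: "'a \<Rightarrow> 'a"
  assumes kconj_add: "kconj (x + y) = kconj x + kconj y"
    and kconj_mult: "kconj (x * y) = kconj y * kconj x"
    and kconj_kconj: "kconj (kconj x) = x"
    and mult_kconj: "x * kconj x = (norm x)\<^sup>2 *\<^sub>R 1"

instantiation real :: conj_div_algebra
begin

definition kconj_real :: "real \<Rightarrow> real"
  where "kconj x = x" for x :: real

instance
  by standard (simp_all add: kconj_real_def power2_eq_square)

end

instantiation complex :: conj_div_algebra
begin

definition kconj_complex :: "complex \<Rightarrow> complex"
  where "kconj x = cnj x" for x :: complex

instance
  by standard
    (simp_all only: kconj_complex_def complex_cnj_add complex_cnj_mult complex_cnj_cnj
      mult.commute complex_mult_cnj cmod_power2 of_real_def)

end

instantiation quat :: conj_div_algebra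
begin

definition kconj_quat :: "quat \<Rightarrow> quat"
  where "kconj x = qcnj x" for x :: quat

instance
proof
  fix x y :: quat
  show "kconj (x + y) = kconj x + kconj y"
    by (simp add: kconj_quat_def quat_eq_iff)
  show "kconj (x * y) = kconj y * kconj x"
    by (simp add: kconj_quat_def quat_eq_iff quat_sel_mult algebra_simps)
  show "kconj (kconj x) = x"
    by (simp add: kconj_quat_def quat_eq_iff)
  have "(norm x)\<^sup>2 = qnorm2 x"
    by (simp add: norm_quat_def qnorm2_def)
  then show "x * kconj x = (norm x)\<^sup>2 *\<^sub>R 1"
    unfolding kconj_quat_def mult_qcnj by (simp add: of_real_def)
qed

end


section \<open>Rank over a division ring\<close>

text \<open>
  Library linear algebra requires commutative scalars, so over a division ring we define the
  rank directly: the maximal number of left linearly independent rows, that is, the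
  dimension of the left vector space spanned by the rows.
\<close>

definition left_independent :: "('a::division_ring ^ 'n) set \<Rightarrow> bool"
  where "left_independent S \<longleftrightarrow>
    (\<forall>c. (\<Sum>v\<in>S. c v *s v) = 0 \<longrightarrow> (\<forall>v\<in>S. c v = 0))"

definition skew_rank :: "'a::division_ring ^ 'n ^ 'm \<Rightarrow> nat"
  where "skew_rank A = Max (card ` {S. S \<subseteq> rows A \<and> left_independent S})"

lemma skew_rank_eq_rank: "skew_rank A = rank A"
  for A :: "'a::field ^ 'n ^ 'm"
proof -
  have fin: "finite (rows A)"
    by (simp add: rows_def full_SetCompr_eq)
  have indep: "left_independent S \<longleftrightarrow> vec.independent S" if "S \<subseteq> rows A" for S
    using finite_subset[OF that fin]
    by (auto simp: left_independent_def vec.dependent_finite)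
  obtain B where B: "B \<subseteq> rows A" "vec.independent B" "rows A \<subseteq> vec.span B"
      "card B = vec.dim (rows A)"
    using vec.basis_exists by blast
  show ?thesis
    unfolding skew_rank_def row_rank_def_gen
  proof (rule Max_eqI)
    show "finite (card ` {S. S \<subseteq> rows A \<and> left_independent S})"
      using fin by simp
    show "vec.dim (rows A) \<in> card ` {S. S \<subseteq> rows A \<and> left_independent S}"
      using B indep by (metis (mono_tags, lifting) image_eqI mem_Collect_eq)
    fix k assume "k \<in> card ` {S. S \<subseteq> rows A \<and> left_independent S}"
    then obtain S where "S \<subseteq> rows A" "left_independent S" "k = card S"
      by blast
    then show "k \<le> vec.dim (rows A)"
      using indep[of S] vec.independent_card_le_dim[of S "rows A"] by simp
  qed
qed


section \<open>Diagonal and permutation matrices\<close>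

definition diagonal_matrix :: "'a::zero ^ 'n ^ 'n \<Rightarrow> bool"
  where "diagonal_matrix D \<longleftrightarrow> (\<forall>i j. i \<noteq> j \<longrightarrow> D $ i $ j = 0)"

definition positive_diagonal :: "'a::real_algebra_1 ^ 'n ^ 'n \<Rightarrow> bool"
  where "positive_diagonal D \<longleftrightarrow>
    diagonal_matrix D \<and> (\<forall>i. \<exists>r>0. D $ i $ i = of_real r)"

definition unitary_diagonal :: "'a::real_normed_div_algebra ^ 'n ^ 'n \<Rightarrow> bool"
  where "unitary_diagonal D \<longleftrightarrow> diagonal_matrix D \<and> (\<forall>i. norm (D $ i $ i) = 1)"

definition permutation_matrix :: "'a::zero_neq_one ^ 'n ^ 'n \<Rightarrow> bool"
  where "permutation_matrix P \<longleftrightarrow>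
    (\<exists>p. bij p \<and> P = (\<chi> i j. if j = p i then 1 else 0))"


section \<open>The Moore-Penrose inverse\<close>

definition conj_transpose :: "'a::conj_div_algebra ^ 'n ^ 'm \<Rightarrow> 'a ^ 'm ^ 'n"
  where "conj_transpose A = (\<chi> i j. kconj (A $ j $ i))"

definition is_moore_penrose :: "'a::conj_div_algebra ^ 'n ^ 'm \<Rightarrow> 'a ^ 'm ^ 'n \<Rightarrow> bool"
  where "is_moore_penrose A X \<longleftrightarrow>
    A ** X ** A = A \<and>
    X ** A ** X = X \<and>
    conj_transpose (A ** X) = A ** X \<and>
    conj_transpose (X ** A) = X ** A"

definition moore_penrose :: "'a::conj_div_algebra ^ 'n ^ 'm \<Rightarrow> 'a ^ 'm ^ 'n"
  where "moore_penrose A = (THE X. is_moore_penrose A X)"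


section \<open>Scale functions and the unit-consistent inverse\<close>

definition general_diagonal_scale_functions ::
  "('a::conj_div_algebra ^ 'n ^ 'm \<Rightarrow> 'a ^ 'm ^ 'm) \<Rightarrow> ('a ^ 'n ^ 'm \<Rightarrow> 'a ^ 'n ^ 'n) \<Rightarrow> bool"
  where "general_diagonal_scale_functions L R \<longleftrightarrow>
    (\<forall>A. positive_diagonal (L A) \<and> positive_diagonal (R A)) \<and>
    (\<forall>A D E. positive_diagonal D \<and> positive_diagonal E \<longrightarrow>
      L (D ** A ** E) ** (D ** A ** E) ** R (D ** A ** E) = L A ** A ** R A) \<and>
    (\<forall>A P Q. permutation_matrix P \<and> permutation_matrix Q \<longrightarrow>
      L (P ** A ** Q) ** (P ** A ** Q) ** R (P ** A ** Q) = P ** (L A ** A ** R A) ** Q) \<and>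
    (\<forall>A D E. unitary_diagonal D \<and> unitary_diagonal E \<longrightarrow>
      L (D ** A ** E) = L A \<and> R (D ** A ** E) = R A)"

definition unit_inverse ::
  "('a::conj_div_algebra ^ 'n ^ 'm \<Rightarrow> 'a ^ 'm ^ 'm) \<Rightarrow> ('a ^ 'n ^ 'm \<Rightarrow> 'a ^ 'n ^ 'n) \<Rightarrow>
    'a ^ 'n ^ 'm \<Rightarrow> 'a ^ 'm ^ 'n"
  where "unit_inverse L R A = R A ** moore_penrose (L A ** A ** R A) ** L A"

end

theory Submission
  imports Defs
begin

text \<open>
  Scaling is logarithmically linear: among all positive scalings of \<open>A\<close> there is one for which the
  nonzero entries of every row and of every column have geometric mean one. Taking logarithms of
  the absolute values, it is obtained by orthogonal projection, so the scaled matrix \<open>S A\<close> is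
  unique, although the scaling factors are not. Hence \<open>S\<close> is invariant under positive diagonal
  scalings and commutes with permutations, and choosing the factors as a function of the absolute
  values makes them invariant under unitary diagonal matrices.

  For nonsingular diagonal \<open>D\<close> and \<open>E\<close>, polar decomposition leaves a unitary part, which passes
  through the Moore--Penrose inverse, and a positive part, which changes the factors by positive
  diagonal \<open>U\<close>, \<open>V\<close> with \<open>U (S A) V = S A\<close>; such a pair satisfies \<open>V (S A)\<^sup>+ U = (S A)\<^sup>+\<close>.
\<close>

section \<open>Rank over a division ring\<close>

text \<open>Gaussian elimination, by induction on the set of equations \<open>T\<close>. The
  unknowns \<open>c s\<close> multiply the coefficients from the left, so the order of factors
  matters throughout.\<close>

lemma underdetermined_system_nontrivial:
  fixes a :: "'s \<Rightarrow> 't \<Rightarrow> 'a::division_ring"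
  assumes "finite T" "finite S" "card T < card S"
  shows "\<exists>c. (\<exists>s\<in>S. c s \<noteq> 0) \<and> (\<forall>t\<in>T. (\<Sum>s\<in>S. c s * a s t) = 0)"
  using assms
proof (induction T arbitrary: S a rule: finite_induct)
  case empty
  then have "S \<noteq> {}"
    by auto
  then show ?case
    by (intro exI[of _ "\<lambda>_. 1"]) auto
next
  case (insert t T)
  show ?case
  proof (cases "\<forall>s\<in>S. a s t = 0")
    case True
    obtain c where "\<exists>s\<in>S. c s \<noteq> 0" "\<forall>u\<in>T. (\<Sum>s\<in>S. c s * a s u) = 0"
      using insert.IH[of S a] insert.prems insert.hyps by auto
    with True show ?thesis
      by (intro exI[of _ c]) auto
  next
    case False
    then obtain p where p: "p \<in> S" "a p t \<noteq> 0"
      by blast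
    \<comment> \<open>Subtracting a left multiple of the pivot row \<open>p\<close> clears equation
      \<open>t\<close>, leaving a system in the unknowns \<open>S - {p}\<close>.\<close>
    define b where "b = (\<lambda>s u. a s u - a s t * inverse (a p t) * a p u)"
    have "card T < card (S - {p})"
      using insert p by simp
    then obtain c where c: "\<exists>s\<in>S-{p}. c s \<noteq> 0" "\<forall>u\<in>T. (\<Sum>s\<in>S-{p}. c s * b s u) = 0"
      using insert.IH[of "S - {p}" b] insert.prems by auto
    \<comment> \<open>The value at \<open>p\<close> absorbs the subtracted multiples, so
      \<open>d\<close> against \<open>a\<close> gives the same sums as \<open>c\<close> against
      \<open>b\<close>.\<close>
    define d where "d = c(p := - (\<Sum>s\<in>S-{p}. c s * (a s t * inverse (a p t))))"
    have split: "(\<Sum>s\<in>S. d s * a s u) = (\<Sum>s\<in>S-{p}. c s * b s u)" for u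
    proof -
      have "(\<Sum>s\<in>S. d s * a s u) = d p * a p u + (\<Sum>s\<in>S-{p}. d s * a s u)"
        using insert.prems p by (simp add: sum.remove)
      also have "(\<Sum>s\<in>S-{p}. d s * a s u) = (\<Sum>s\<in>S-{p}. c s * a s u)"
        by (rule sum.cong) (auto simp: d_def)
      also have "d p * a p u + \<dots> = (\<Sum>s\<in>S-{p}. c s * b s u)"
        by (simp add: d_def b_def sum_distrib_right right_diff_distrib sum_subtractf mult.assoc)
      finally show ?thesis .
    qed
    have "b s t = 0" for s
      using p by (simp add: b_def mult.assoc)
    then have "(\<Sum>s\<in>S. d s * a s u) = 0" if "u \<in> insert t T" for u
      using that c by (auto simp: split)
    moreover have "\<exists>s\<in>S. d s \<noteq> 0"
      using c by (auto simp: d_def)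
    ultimately show ?thesis
      by blast
  qed
qed

text \<open>Steinitz bound: if \<open>S\<close> were larger than \<open>T\<close>, the coefficient
  rows of its vectors would satisfy a nontrivial left relation, which carries over to the vectors.
  The spanning vectors are an indexed family \<open>f\<close>, so they may coincide.\<close>

lemma left_independent_card_le:
  fixes S :: "('a::division_ring ^ 'n) set"
  assumes "left_independent S" "finite S" "finite T"
    and span: "\<And>s. s \<in> S \<Longrightarrow> \<exists>a. s = (\<Sum>t\<in>T. a t *s f t)"
  shows "card S \<le> card T"
proof (rule ccontr)
  assume "\<not> card S \<le> card T"
  obtain a where a: "\<And>s. s \<in> S \<Longrightarrow> s = (\<Sum>t\<in>T. a s t *s f t)"
    using span by metis
  obtain c where c: "\<exists>s\<in>S. c s \<noteq> 0" "\<forall>t\<in>T. (\<Sum>s\<in>S. c s * a s t) = 0"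
    using underdetermined_system_nontrivial[of T S a] \<open>\<not> card S \<le> card T\<close> assms by auto
  have "(\<Sum>s\<in>S. c s *s s) = (\<Sum>s\<in>S. \<Sum>t\<in>T. (c s * a s t) *s f t)"
  proof (rule sum.cong[OF refl])
    fix s assume "s \<in> S"
    have "c s *s s = c s *s (\<Sum>t\<in>T. a s t *s f t)"
      using a[OF \<open>s \<in> S\<close>] by simp
    then show "c s *s s = (\<Sum>t\<in>T. (c s * a s t) *s f t)"
      by (simp add: vec_eq_iff sum_distrib_left mult.assoc)
  qed
  also have "\<dots> = (\<Sum>t\<in>T. (\<Sum>s\<in>S. c s * a s t) *s f t)"
    by (subst sum.swap) (simp add: vec_eq_iff sum_distrib_right)
  also have "\<dots> = 0"
    using c by simp
  finally show False
    using c \<open>left_independent S\<close> unfolding left_independent_def by blast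
qed

text \<open>A relation with nonzero coefficient at \<open>v\<close> could be solved for
  \<open>v\<close> by multiplying with the inverse from the left.\<close>

lemma left_independent_insert:
  fixes S :: "('a::division_ring ^ 'n) set"
  assumes "left_independent S" "finite S" "\<nexists>a. v = (\<Sum>s\<in>S. a s *s s)"
  shows "left_independent (insert v S)" "v \<notin> S"
proof -
  show vS: "v \<notin> S"
  proof
    assume "v \<in> S"
    moreover define a where "a s = (if s = v then 1 else 0 :: 'a)" for s
    then have "a s *s s = (if s = v then v else 0)" for s
      by simp
    ultimately have "v = (\<Sum>s\<in>S. a s *s s)"
      using \<open>finite S\<close> by simp
    then show False
      using assms(3) by blast
  qed
  show "left_independent (insert v S)"
    unfolding left_independent_def
  proof (intro allI impI)
    fix c assume "(\<Sum>w\<in>insert v S. c w *s w) = 0"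
    then have sum0: "c v *s v + (\<Sum>w\<in>S. c w *s w) = 0"
      using vS \<open>finite S\<close> by simp
    have "c v = 0"
    proof (rule ccontr)
      assume nz: "c v \<noteq> 0"
      define a where "a s = - (inverse (c v) * c s)" for s
      have "v = (\<Sum>s\<in>S. a s *s s)"
      proof (rule vec_eq_iff[THEN iffD2], rule allI)
        fix i
        have "c v * v $ i = - (\<Sum>w\<in>S. c w * w $ i)"
          using sum0 by (simp add: vec_eq_iff eq_neg_iff_add_eq_0)
        then have "inverse (c v) * (c v * v $ i) = inverse (c v) * - (\<Sum>w\<in>S. c w * w $ i)"
          by simp
        then show "v $ i = (\<Sum>s\<in>S. a s *s s) $ i"
          using nz by (simp add: a_def mult.assoc[symmetric] sum_distrib_left sum_negf)
      qed
      then show False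
        using assms(3) by blast
    qed
    with sum0 assms(1) show "\<forall>w\<in>insert v S. c w = 0"
      by (auto simp: left_independent_def)
  qed
qed

section \<open>Row bases and the rank of a product\<close>

lemma finite_rows: "finite (rows A)"
  by (simp add: rows_def full_SetCompr_eq)

lemma skew_rank_attained:
  fixes A :: "'a::division_ring ^ 'n ^ 'm"
  obtains S where "S \<subseteq> rows A" "left_independent S" "card S = skew_rank A"
proof -
  have "left_independent ({} :: ('a ^ 'n) set)"
    by (simp add: left_independent_def)
  then have "{S. S \<subseteq> rows A \<and> left_independent S} \<noteq> {}"
    by blast
  then have "skew_rank A \<in> card ` {S. S \<subseteq> rows A \<and> left_independent S}"
    unfolding skew_rank_def by (intro Max_in) (auto simp: finite_rows)
  with that show ?thesis
    by auto
qed

lemma left_independent_card_le_skew_rank: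
  assumes "S \<subseteq> rows A" "left_independent S"
  shows "card S \<le> skew_rank A"
  unfolding skew_rank_def using assms by (intro Max_ge) (auto simp: finite_rows)

text \<open>An independent set of rows of maximal size spans all rows, since a row outside its span
  could be added.\<close>

lemma skew_rank_basis:
  fixes A :: "'a::division_ring ^ 'n ^ 'm"
  obtains S where "finite S" "card S = skew_rank A"
    "\<And>i. \<exists>a. row i A = (\<Sum>s\<in>S. a s *s s)"
proof -
  obtain S where S: "S \<subseteq> rows A" "left_independent S" "card S = skew_rank A"
    by (rule skew_rank_attained)
  then have fin: "finite S"
    using finite_rows finite_subset by blast
  have "\<exists>a. row i A = (\<Sum>s\<in>S. a s *s s)" for i
  proof (rule ccontr)
    assume *: "\<nexists>a. row i A = (\<Sum>s\<in>S. a s *s s)"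
    have "insert (row i A) S \<subseteq> rows A"
      using S by (auto simp: rows_def)
    with left_independent_insert[OF S(2) fin *] have "card (insert (row i A) S) \<le> skew_rank A"
      by (intro left_independent_card_le_skew_rank)
    with left_independent_insert[OF S(2) fin *] fin S show False
      by simp
  qed
  with fin S that show ?thesis
    by blast
qed

text \<open>If \<open>S\<close> spans the rows of \<open>A\<close>, the vectors
  \<open>s v* C\<close> span the rows of \<open>B ** A ** C\<close>: left factors combine rows, and
  right factors act on them left-linearly. Both sides are thus handled by row rank.\<close>

lemma skew_rank_mult_le:
  fixes A :: "'a::division_ring ^ 'n ^ 'm"
  shows "skew_rank (B ** A ** C) \<le> skew_rank A"
proof -
  obtain S where S: "finite S" "card S = skew_rank A"
    "\<And>i. \<exists>a. row i A = (\<Sum>s\<in>S. a s *s s)"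
    by (rule skew_rank_basis) blast
  obtain a where "\<And>i. row i A = (\<Sum>s\<in>S. a i s *s s)"
    using S(3) by metis
  then have a: "A $ i $ j = (\<Sum>s\<in>S. a i s * s $ j)" for i j
    by (simp add: row_def vec_eq_iff)
  obtain T where T: "T \<subseteq> rows (B ** A ** C)" "left_independent T"
    "card T = skew_rank (B ** A ** C)"
    by (rule skew_rank_attained)
  have "\<exists>b. row i (B ** A ** C) = (\<Sum>s\<in>S. b s *s (s v* C))" for i
  proof
    show "row i (B ** A ** C) = (\<Sum>s\<in>S. (\<Sum>k\<in>UNIV. B $ i $ k * a k s) *s (s v* C))"
    proof (rule vec_eq_iff[THEN iffD2], rule allI)
      fix l
      have "row i (B ** A ** C) $ l
          = (\<Sum>j\<in>UNIV. \<Sum>k\<in>UNIV. \<Sum>s\<in>S. B $ i $ k * (a k s * (s $ j * C $ j $ l)))"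
        by (simp add: row_def matrix_matrix_mult_def a sum_distrib_left sum_distrib_right mult.assoc)
      also have "\<dots> = (\<Sum>s\<in>S. \<Sum>j\<in>UNIV. \<Sum>k\<in>UNIV. B $ i $ k * (a k s * (s $ j * C $ j $ l)))"
        by (simp only: sum.swap[of _ S])
      also have "\<dots> = (\<Sum>s\<in>S. (\<Sum>k\<in>UNIV. B $ i $ k * a k s) *s (s v* C)) $ l"
        by (simp add: vector_matrix_mult_def sum_distrib_left sum_distrib_right mult.assoc)
      finally show "row i (B ** A ** C) $ l
          = (\<Sum>s\<in>S. (\<Sum>k\<in>UNIV. B $ i $ k * a k s) *s (s v* C)) $ l" .
    qed
  qed
  then have "card T \<le> card S"
    using T S(1) finite_subset[OF T(1) finite_rows]
    by (intro left_independent_card_le[where f = "\<lambda>s. s v* C"]) (auto simp: rows_def)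
  then show ?thesis
    by (simp add: S T)
qed

section \<open>The conjugate transpose\<close>

lemma kconj_0 [simp]: "kconj (0 :: 'a::conj_div_algebra) = 0"
  using kconj_add[of "0 :: 'a" 0] by simp

lemma kconj_sum: "kconj (sum f S) = (\<Sum>x\<in>S. kconj (f x :: 'a::conj_div_algebra))"
  by (induction S rule: infinite_finite_induct) (simp_all add: kconj_add)

text \<open>Take norms in \<open>x * kconj x = |x|^2\<close> and cancel
  \<open>norm x\<close>.\<close>

lemma norm_kconj: "norm (kconj x) = norm (x :: 'a::conj_div_algebra)"
proof (cases "x = 0")
  case False
  have "norm x * norm (kconj x) = (norm x)\<^sup>2"
    by (simp flip: norm_mult add: mult_kconj)
  with False show ?thesis
    by (simp add: power2_eq_square)
qed simp

lemma kconj_mult_self: "kconj x * x = (norm (x :: 'a::conj_div_algebra))\<^sup>2 *\<^sub>R 1"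
  using mult_kconj[of "kconj x"] by (simp add: kconj_kconj norm_kconj)

text \<open>For \<open>r \<noteq> 0\<close>, cancel \<open>of_real r\<close> from
  \<open>x * kconj x = |x|^2\<close>.\<close>

lemma kconj_of_real [simp]: "kconj (of_real r :: 'a::conj_div_algebra) = of_real r"
proof (cases "r = 0")
  case False
  have "of_real r * kconj (of_real r) = (of_real r * of_real r :: 'a)"
    by (subst mult_kconj) (simp add: of_real_def power2_eq_square)
  with False show ?thesis
    by simp
qed simp

lemma conj_transpose_mult: "conj_transpose (A ** B) = conj_transpose B ** conj_transpose A"
  by (simp add: conj_transpose_def matrix_matrix_mult_def vec_eq_iff kconj_sum kconj_mult)

lemma conj_transpose_conj_transpose [simp]: "conj_transpose (conj_transpose A) = A"
  by (simp add: conj_transpose_def vec_eq_iff kconj_kconj)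

lemma conj_transpose_congruence:
  "conj_transpose (U ** H ** conj_transpose U) = U ** conj_transpose H ** conj_transpose U"
  by (simp add: conj_transpose_mult matrix_mul_assoc)

lemma conj_transpose_add: "conj_transpose (A + B) = conj_transpose A + conj_transpose B"
  by (simp add: conj_transpose_def vec_eq_iff kconj_add)

lemma conj_transpose_0 [simp]: "conj_transpose 0 = 0"
  by (simp add: conj_transpose_def vec_eq_iff)

lemma conj_transpose_scaleR: "conj_transpose (r *\<^sub>R A) = r *\<^sub>R conj_transpose A"
proof -
  have "kconj (r *\<^sub>R x) = r *\<^sub>R kconj x" for x :: 'a
    using kconj_mult[of "of_real r" x] by (simp only: kconj_of_real) (simp add: of_real_def)
  then show ?thesis
    by (simp add: conj_transpose_def vec_eq_iff)
qed

text \<open>With columns encoded as matrices of width one, the squared length is a real multiple of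
  the identity and so moves freely through products, even over the quaternions.\<close>

lemma conj_transpose_mult_column:
  fixes v :: "'a::conj_div_algebra ^ 1 ^ 'm"
  shows "conj_transpose v ** v = (\<Sum>i\<in>UNIV. (norm (v $ i $ 1))\<^sup>2) *\<^sub>R mat 1"
  by (simp add: vec_eq_iff conj_transpose_def matrix_matrix_mult_def mat_def kconj_mult_self
      scaleR_sum_left)

section \<open>Existence and uniqueness of the Moore--Penrose inverse\<close>

lemma matrix_scaleR_mult:
  fixes A :: "'a::real_algebra_1 ^ 'n ^ 'm"
  shows "(r *\<^sub>R A) ** B = r *\<^sub>R (A ** B)" "A ** (r *\<^sub>R C) = r *\<^sub>R (A ** C)"
  by (simp_all add: matrix_matrix_mult_def vec_eq_iff scaleR_sum_right)

lemma matrix_add_mult_distrib: "(A + B) ** C = A ** C + B ** C"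
  by (simp add: matrix_matrix_mult_def vec_eq_iff distrib_right sum.distrib)

lemma matrix_mult_zero [simp]: "0 ** A = 0" "A ** 0 = 0"
  by (simp_all add: matrix_matrix_mult_def vec_eq_iff)

text \<open>Gram--Schmidt: the columns are added one at a time to the range of the projector.\<close>

lemma columns_projector:
  fixes A :: "'a::conj_div_algebra ^ 'n ^ 'm"
  assumes "finite J"
  shows "\<exists>X. conj_transpose (A ** X) = A ** X \<and> A ** X ** (A ** X) = A ** X \<and>
    (\<forall>j\<in>J. \<forall>i. (A ** X ** A) $ i $ j = A $ i $ j)"
  using assms
proof (induction J rule: finite_induct)
  case empty
  show ?case
    by (rule exI[of _ 0]) simp
next
  case (insert k J)
  then obtain X where herm: "conj_transpose (A ** X) = A ** X"
    and idem: "A ** X ** (A ** X) = A ** X"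
    and cols: "\<And>j i. j \<in> J \<Longrightarrow> (A ** X ** A) $ i $ j = A $ i $ j"
    by blast
  define P where "P = A ** X"
  \<comment> \<open>Unit columns: \<open>A ** e j\<close> is column \<open>j\<close> of
    \<open>A\<close>.\<close>
  define e where "e j = (\<chi> i c. if i = j then 1 else 0 :: 'a ^ 1 ^ 'n)" for j
  have e: "(B ** e j) $ i $ c = B $ i $ j" for B :: "'a ^ 'n ^ 'm" and i c j
    by (simp add: matrix_matrix_mult_def e_def if_distrib cong: if_cong)
  have fixes_iff: "(\<forall>i. (Q ** A) $ i $ j = A $ i $ j) \<longleftrightarrow> Q ** (A ** e j) = A ** e j" for Q j
    by (simp add: vec_eq_iff e matrix_mul_assoc)
  \<comment> \<open>\<open>v = A ** w\<close> is the part of column \<open>k\<close> orthogonal to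
    the range of \<open>P\<close>; this form keeps the enlarged projector of the shape
    \<open>A ** Y\<close>.\<close>
  define w where "w = e k - X ** (A ** e k)"
  define v where "v = A ** w"
  have v: "v + P ** (A ** e k) = A ** e k"
    by (simp add: v_def w_def P_def matrix_mul_assoc flip: matrix_add_ldistrib)
      (simp flip: matrix_mul_assoc matrix_add_ldistrib)
  have P: "conj_transpose P = P" "P ** P = P"
    using herm idem by (simp_all add: P_def)
  have Pv: "P ** v = 0"
    using arg_cong[OF v, of "\<lambda>x. P ** x"] by (simp add: matrix_add_ldistrib matrix_mul_assoc P)
  then have vP: "conj_transpose v ** P = 0"
    using conj_transpose_mult[of P v] by (simp add: P)
  obtain c where c: "conj_transpose v ** v = c *\<^sub>R mat 1" "v \<noteq> 0 \<Longrightarrow> c \<noteq> 0"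
  proof
    show "conj_transpose v ** v = (\<Sum>i\<in>UNIV. (norm (v $ i $ 1))\<^sup>2) *\<^sub>R mat 1"
      by (rule conj_transpose_mult_column)
    show "(\<Sum>i\<in>UNIV. (norm (v $ i $ 1))\<^sup>2) \<noteq> 0" if "v \<noteq> 0"
      using that by (subst sum_nonneg_eq_0_iff) (auto simp: vec_eq_iff forall_1)
  qed
  \<comment> \<open>The correction adds the projector onto the line of \<open>v\<close> to
    \<open>P\<close>. If \<open>v = 0\<close> it vanishes.\<close>
  define Y where "Y = X + inverse c *\<^sub>R (w ** conj_transpose v)"
  define Q where "Q = A ** Y"
  have Q: "Q = P + inverse c *\<^sub>R (v ** conj_transpose v)"
    by (simp add: Q_def Y_def P_def v_def matrix_add_ldistrib matrix_scaleR_mult matrix_mul_assoc)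
  have Qmult: "Q ** B = P ** B + inverse c *\<^sub>R (v ** (conj_transpose v ** B))" for B :: "'a ^ 'l ^ 'm"
    by (simp add: Q matrix_add_mult_distrib matrix_scaleR_mult matrix_mul_assoc)
  have Qv: "Q ** v = v"
  proof (cases "v = 0")
    case False
    then show ?thesis
      by (simp add: Qmult Pv c matrix_scaleR_mult)
  qed simp
  have QP: "Q ** P = P"
    by (simp add: Qmult P vP)
  have "conj_transpose Q = Q"
    by (simp add: Q conj_transpose_add conj_transpose_scaleR conj_transpose_mult P)
  moreover have "Q ** Q = Q"
    by (subst (2 3) Q)
      (simp add: matrix_add_ldistrib matrix_scaleR_mult matrix_mul_assoc QP Qv)
  moreover have "Q ** (A ** e j) = A ** e j" if "j \<in> insert k J" for j
  proof (cases "j = k")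
    case True
    have "Q ** (A ** e k) = Q ** v + Q ** P ** (A ** e k)"
      by (subst v[symmetric]) (simp add: matrix_add_ldistrib matrix_mul_assoc)
    with True v show ?thesis
      by (simp add: Qv QP)
  next
    case False
    then have "P ** (A ** e j) = A ** e j"
      using that cols by (simp add: P_def flip: fixes_iff)
    then show ?thesis
      by (metis QP matrix_mul_assoc)
  qed
  ultimately show ?case
    unfolding fixes_iff Q_def by blast
qed

lemma inner_inverse_left_hermitian:
  fixes A :: "'a::conj_div_algebra ^ 'n ^ 'm"
  shows "\<exists>X. A ** X ** A = A \<and> conj_transpose (A ** X) = A ** X"
  using columns_projector[of UNIV A] by (metis UNIV_I finite vec_eq_iff)

text \<open>The left-hand version applied to \<open>conj_transpose A\<close>, then
  conjugate-transposed.\<close>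

lemma inner_inverse_right_hermitian:
  fixes A :: "'a::conj_div_algebra ^ 'n ^ 'm"
  shows "\<exists>X. A ** X ** A = A \<and> conj_transpose (X ** A) = X ** A"
proof -
  obtain Y where Y: "conj_transpose A ** Y ** conj_transpose A = conj_transpose A"
    "conj_transpose (conj_transpose A ** Y) = conj_transpose A ** Y"
    using inner_inverse_left_hermitian by blast
  have "A ** conj_transpose Y ** A = A"
    using arg_cong[OF Y(1), of conj_transpose] by (simp add: conj_transpose_mult matrix_mul_assoc)
  moreover have "conj_transpose (conj_transpose Y ** A) = conj_transpose Y ** A"
    using Y(2) by (simp add: conj_transpose_mult)
  ultimately show ?thesis
    by blast
qed

text \<open>For one-sided inverses \<open>X\<close> and \<open>Y\<close> as above,
  \<open>Z = Y ** A ** X\<close> has \<open>A ** Z = A ** X\<close> and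
  \<open>Z ** A = Y ** A\<close>, both Hermitian.\<close>

lemma moore_penrose_exists: "\<exists>X. is_moore_penrose A X"
proof -
  obtain X where X: "A ** X ** A = A" "conj_transpose (A ** X) = A ** X"
    using inner_inverse_left_hermitian by blast
  obtain Y where Y: "A ** Y ** A = A" "conj_transpose (Y ** A) = Y ** A"
    using inner_inverse_right_hermitian by blast
  have "A ** (Y ** A ** X) = A ** X" "Y ** A ** X ** A = Y ** A"
    using X(1) Y(1) by (metis matrix_mul_assoc)+
  with X Y have "is_moore_penrose A (Y ** A ** X)"
    unfolding is_moore_penrose_def by (metis matrix_mul_assoc)
  then show ?thesis
    by blast
qed

text \<open>Taking adjoints of products of the Hermitian projectors gives
  \<open>A ** X = A ** Y\<close> and \<open>X ** A = Y ** A\<close>; then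
  \<open>X = X ** A ** X = Y ** A ** Y = Y\<close>.\<close>

lemma moore_penrose_unique:
  assumes "is_moore_penrose A X" "is_moore_penrose A Y"
  shows "X = Y"
proof -
  have X: "A ** X ** A = A" "X ** A ** X = X" "conj_transpose (A ** X) = A ** X"
    "conj_transpose (X ** A) = X ** A"
    and Y: "A ** Y ** A = A" "Y ** A ** Y = Y" "conj_transpose (A ** Y) = A ** Y"
    "conj_transpose (Y ** A) = Y ** A"
    using assms by (simp_all add: is_moore_penrose_def)
  have "A ** X = conj_transpose (A ** Y ** (A ** X))"
    using X Y by (simp add: matrix_mul_assoc)
  also have "\<dots> = A ** X ** (A ** Y)"
    using X Y by (simp add: conj_transpose_mult[of "A ** Y"])
  also have "\<dots> = A ** Y"
    using X by (simp add: matrix_mul_assoc)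
  finally have left: "A ** X = A ** Y" .
  have "X ** A = conj_transpose (X ** A ** (Y ** A))"
    using X Y by (simp flip: matrix_mul_assoc)
  also have "\<dots> = Y ** A ** (X ** A)"
    using X Y by (simp add: conj_transpose_mult[of "X ** A"])
  also have "\<dots> = Y ** A"
    using X by (simp flip: matrix_mul_assoc)
  finally have right: "X ** A = Y ** A" .
  show ?thesis
    using X Y left right by (metis matrix_mul_assoc)
qed

section \<open>The Moore--Penrose inverse under two-sided multiplication\<close>

lemma is_moore_penrose_moore_penrose: "is_moore_penrose A (moore_penrose A)"
  unfolding moore_penrose_def
  using moore_penrose_exists moore_penrose_unique by (metis (mono_tags) theI)

lemma moore_penrose_eqI: "is_moore_penrose A X \<Longrightarrow> moore_penrose A = X"
  using is_moore_penrose_moore_penrose moore_penrose_unique by blast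

text \<open>After cancellation both products with the candidate are congruences of
  \<open>A ** X\<close> and \<open>X ** A\<close>, which preserve Hermitian matrices.\<close>

lemma moore_penrose_unitary:
  fixes A :: "'a::conj_div_algebra ^ 'n ^ 'm"
  assumes "conj_transpose U ** U = mat 1" "V ** conj_transpose V = mat 1"
  shows "moore_penrose (U ** A ** V) = conj_transpose V ** moore_penrose A ** conj_transpose U"
proof (rule moore_penrose_eqI)
  define X where "X = moore_penrose A"
  have X: "A ** X ** A = A" "X ** A ** X = X" "conj_transpose (A ** X) = A ** X"
    "conj_transpose (X ** A) = X ** A"
    using is_moore_penrose_moore_penrose[of A] by (simp_all add: is_moore_penrose_def X_def)
  have U: "B ** conj_transpose U ** U = B" for B :: "'a ^ 'm ^ 'k"
    using assms(1) by (simp flip: matrix_mul_assoc)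
  have V: "B ** V ** conj_transpose V = B" for B :: "'a ^ 'n ^ 'k"
    using assms(2) by (simp flip: matrix_mul_assoc)
  define Z where "Z = conj_transpose V ** X ** conj_transpose U"
  have l: "U ** A ** V ** Z = U ** (A ** X) ** conj_transpose U"
    by (simp add: Z_def matrix_mul_assoc V)
  have r: "Z ** (U ** A ** V) = conj_transpose V ** (X ** A) ** V"
    by (simp add: Z_def matrix_mul_assoc U)
  have "conj_transpose (U ** A ** V ** Z) = U ** A ** V ** Z"
    unfolding l by (simp add: conj_transpose_congruence X)
  moreover have "conj_transpose (Z ** (U ** A ** V)) = Z ** (U ** A ** V)"
    unfolding r using conj_transpose_congruence[of "conj_transpose V" "X ** A"] by (simp add: X)
  moreover have "U ** A ** V ** Z ** (U ** A ** V) = U ** (A ** X ** A) ** V"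
    unfolding l by (simp add: matrix_mul_assoc U)
  moreover have "Z ** (U ** A ** V) ** Z = conj_transpose V ** (X ** A ** X) ** conj_transpose U"
    unfolding r by (simp add: Z_def matrix_mul_assoc V)
  ultimately have "is_moore_penrose (U ** A ** V) Z"
    by (simp add: is_moore_penrose_def X) (simp add: Z_def)
  then show "is_moore_penrose (U ** A ** V)
    (conj_transpose V ** moore_penrose A ** conj_transpose U)"
    by (simp add: Z_def X_def)
qed

text \<open>Stability lets \<open>U\<close> and \<open>V\<close> pass through \<open>A\<close> as
  \<open>A ** V = U' ** A\<close> and \<open>U ** A = A ** V'\<close>. Hence \<open>V\<close>
  commutes with the projector \<open>X ** A\<close> and \<open>U\<close> with \<open>A ** X\<close>,
  after which \<open>U'\<close> and \<open>U\<close> cancel.\<close>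

lemma moore_penrose_stabilizer:
  assumes herm: "conj_transpose U = U" "conj_transpose V = V"
    and inv: "U' ** U = mat 1" "V ** V' = mat 1"
    and stab: "U ** A ** V = A"
  shows "V ** moore_penrose A ** U = moore_penrose A"
proof -
  define X where "X = moore_penrose A"
  have X: "A ** X ** A = A" "X ** A ** X = X" "conj_transpose (A ** X) = A ** X"
    "conj_transpose (X ** A) = X ** A"
    using is_moore_penrose_moore_penrose[of A] by (simp_all add: is_moore_penrose_def X_def)
  have AV: "A ** V = U' ** A"
    by (metis inv(1) stab matrix_mul_assoc matrix_mul_lid)
  have UA: "U ** A = A ** V'"
    by (metis inv(2) stab matrix_mul_assoc matrix_mul_rid)
  define H where "H = A ** X"
  define K where "K = X ** A"
  have "K ** V ** K = X ** U' ** (A ** X ** A)"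
    by (metis K_def AV matrix_mul_assoc)
  also have "\<dots> = K ** V"
    by (metis X(1) K_def AV matrix_mul_assoc)
  finally have KVK: "K ** V ** K = K ** V" .
  \<comment> \<open>\<open>K ** V ** K\<close> is Hermitian, so the equal matrix
    \<open>K ** V\<close> agrees with its adjoint \<open>V ** K\<close>.\<close>
  have KV: "V ** K = K ** V"
  proof -
    have "conj_transpose K = K"
      using X(4) by (simp add: K_def)
    then have "conj_transpose (K ** V ** K) = K ** V ** K" "conj_transpose (K ** V) = V ** K"
      by (simp_all add: conj_transpose_mult herm matrix_mul_assoc)
    then show ?thesis
      using KVK by simp
  qed
  have "H ** U ** H = A ** X ** A ** V' ** X"
    by (metis H_def UA matrix_mul_assoc)
  also have "\<dots> = U ** H"
    by (metis X(1) H_def UA matrix_mul_assoc)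
  finally have HUH: "H ** U ** H = U ** H" .
  have HU: "H ** U = U ** H"
  proof -
    have "conj_transpose H = H"
      using X(3) by (simp add: H_def)
    then have "conj_transpose (H ** U ** H) = H ** U ** H" "conj_transpose (U ** H) = H ** U"
      by (simp_all add: conj_transpose_mult herm matrix_mul_assoc)
    then show ?thesis
      using HUH by simp
  qed
  have "V ** X ** U = V ** K ** X ** U"
    by (metis X(2) K_def matrix_mul_assoc)
  also have "\<dots> = X ** (A ** V) ** X ** U"
    by (metis KV K_def matrix_mul_assoc)
  also have "\<dots> = X ** U' ** (H ** U)"
    by (metis AV H_def matrix_mul_assoc)
  also have "\<dots> = X ** H"
    by (metis HU inv(1) matrix_mul_assoc matrix_mul_rid)
  also have "\<dots> = X"
    by (metis X(2) H_def matrix_mul_assoc)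
  finally show ?thesis
    by (simp add: X_def)
qed

section \<open>Balanced scalings\<close>

text \<open>
  The geometric mean of the nonzero entries is one in every row and column. Zero entries do not
  contribute because \<open>ln 0 = 0\<close>.
\<close>

definition balances :: "real ^ 'n ^ 'm \<Rightarrow> ('m \<Rightarrow> real) \<Rightarrow> ('n \<Rightarrow> real) \<Rightarrow> bool"
  where "balances M l r \<longleftrightarrow> (\<forall>i. 0 < l i) \<and> (\<forall>j. 0 < r j) \<and>
    (\<forall>i. (\<Sum>j\<in>UNIV. ln (l i * M $ i $ j * r j)) = 0) \<and>
    (\<forall>j. (\<Sum>i\<in>UNIV. ln (l i * M $ i $ j * r j)) = 0)"

text \<open>
  In logarithmic coordinates a scaling adds an element of the space \<open>W\<close> to the vector of
  logarithms of the nonzero entries, and it balances the matrix when the result is orthogonal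
  to \<open>W\<close>.
\<close>

lemma balances_exists:
  fixes M :: "real ^ 'n ^ 'm"
  assumes nonneg: "\<And>i j. 0 \<le> M $ i $ j"
  shows "\<exists>l r. balances M l r"
proof -
  define g :: "(real ^ 'm) \<times> (real ^ 'n) \<Rightarrow> real ^ 'n ^ 'm"
    where "g p = (\<chi> i j. if M $ i $ j = 0 then 0 else fst p $ i + snd p $ j)" for p
  define W where "W = range g"
  have "linear g"
    by (rule linearI) (auto simp: g_def vec_eq_iff algebra_simps)
  then have "subspace W"
    unfolding W_def by (intro linear_subspace_image) auto
  then have span: "span W = W"
    by (rule span_eq_iff[THEN iffD2])
  obtain y z where yz: "y \<in> span W" "\<And>w. w \<in> span W \<Longrightarrow> orthogonal z w"
    "(\<chi> i j. ln (M $ i $ j)) = y + z"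
    using orthogonal_subspace_decomp_exists by blast
  obtain p where "y = g p"
    using yz(1) unfolding span unfolding W_def by (rule rangeE)
  \<comment> \<open>The scaling must remove the component \<open>y\<close> in \<open>W\<close>,
    hence the sign change.\<close>
  then obtain x where x: "y = g (- x)"
    using minus_minus[of p] by metis
  define l where "l i = exp (fst x $ i)" for i
  define r where "r j = exp (snd x $ j)" for j
  have z: "ln (l i * M $ i $ j * r j) = z $ i $ j" for i j
  proof (cases "M $ i $ j = 0")
    case True
    then show ?thesis
      using arg_cong[OF yz(3), of "\<lambda>v. v $ i $ j"] by (simp add: x g_def)
  next
    case False
    with nonneg[of i j] have "0 < M $ i $ j"
      by simp
    moreover have "ln (M $ i $ j) = - fst x $ i - snd x $ j + z $ i $ j"
      using arg_cong[OF yz(3), of "\<lambda>v. v $ i $ j"] False by (simp add: x g_def)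
    ultimately show ?thesis
      by (simp add: l_def r_def ln_mult)
  qed
  have z0: "z $ i $ j = 0" if "M $ i $ j = 0" for i j
    using z[of i j] that by simp
  have orth: "(\<Sum>i\<in>UNIV. \<Sum>j\<in>UNIV. z $ i $ j * (a i + b j)) = 0" for a b
  proof -
    have "g (\<chi> i. a i, \<chi> j. b j) \<in> span W"
      unfolding span unfolding W_def by (rule rangeI)
    then have "z \<bullet> g (\<chi> i. a i, \<chi> j. b j) = 0"
      using yz(2) by (simp add: orthogonal_def)
    moreover have "z \<bullet> g (\<chi> i. a i, \<chi> j. b j) = (\<Sum>i\<in>UNIV. \<Sum>j\<in>UNIV. z $ i $ j * (a i + b j))"
      unfolding inner_vec_def by (intro sum.cong refl) (auto simp: g_def z0)
    ultimately show ?thesis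
      by simp
  qed
  \<comment> \<open>Orthogonality to the indicator of row \<open>k\<close>, and below to that of
    column \<open>k\<close>, isolates a single sum.\<close>
  have "(\<Sum>j\<in>UNIV. z $ k $ j) = 0" for k
  proof -
    have "(\<Sum>j\<in>UNIV. z $ k $ j) = (\<Sum>i\<in>UNIV. if i = k then \<Sum>j\<in>UNIV. z $ i $ j else 0)"
      by simp
    also have "\<dots> = (\<Sum>i\<in>UNIV. \<Sum>j\<in>UNIV. z $ i $ j * ((if i = k then 1 else 0) + 0))"
      by (intro sum.cong refl) auto
    finally show ?thesis
      using orth[of "\<lambda>i. if i = k then 1 else 0" "\<lambda>_. 0"] by simp
  qed
  moreover have "(\<Sum>i\<in>UNIV. z $ i $ k) = 0" for k
    using orth[of "\<lambda>_. 0" "\<lambda>j. if j = k then 1 else 0"] by (simp add: if_distrib cong: if_cong)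
  ultimately have "balances M l r"
    by (simp add: balances_def z) (simp add: l_def r_def)
  then show ?thesis
    by blast
qed

text \<open>The difference \<open>c\<close> of two balanced logarithmic matrices lies in the space
  of logarithmic scalings and is orthogonal to it, so its squared norm is zero.\<close>

lemma balances_unique:
  assumes nonneg: "\<And>i j. 0 \<le> M $ i $ j"
    and bal: "balances M l r" "balances M l' r'"
    and nz: "M $ i $ j \<noteq> 0"
  shows "l i * r j = l' i * r' j"
proof -
  have pos: "0 < l i" "0 < r j" "0 < l' i" "0 < r' j" for i j
    using bal by (auto simp: balances_def)
  define u where "u i = ln (l i) - ln (l' i)" for i
  define v where "v j = ln (r j) - ln (r' j)" for j
  define c where "c i j = ln (l i * M $ i $ j * r j) - ln (l' i * M $ i $ j * r' j)" for i j
  have c: "c i j = (if M $ i $ j = 0 then 0 else u i + v j)" for i j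
    using nonneg[of i j] pos by (auto simp: c_def u_def v_def ln_mult less_le)
  have rows0: "(\<Sum>j\<in>UNIV. c i j) = 0" for i
    using bal by (simp add: c_def sum_subtractf balances_def)
  have cols0: "(\<Sum>i\<in>UNIV. c i j) = 0" for j
    using bal by (simp add: c_def sum_subtractf balances_def)
  \<comment> \<open>One factor of the square may be replaced by \<open>u i + v j\<close> even at
    zero entries, where \<open>c i j = 0\<close>.\<close>
  have "(\<Sum>i\<in>UNIV. \<Sum>j\<in>UNIV. (c i j)\<^sup>2) = (\<Sum>i\<in>UNIV. \<Sum>j\<in>UNIV. u i * c i j + v j * c i j)"
    by (intro sum.cong refl) (simp add: c power2_eq_square algebra_simps)
  also have "\<dots> = (\<Sum>i\<in>UNIV. u i * (\<Sum>j\<in>UNIV. c i j)) + (\<Sum>j\<in>UNIV. v j * (\<Sum>i\<in>UNIV. c i j))"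
    unfolding sum.distrib sum_distrib_left
    by (subst (2) sum.swap) simp
  also have "\<dots> = 0"
    by (simp add: rows0 cols0)
  finally have "c i j = 0"
    by (simp add: sum_nonneg_eq_0_iff sum_nonneg)
  moreover have "l i \<noteq> 0" "r j \<noteq> 0" "l' i \<noteq> 0" "r' j \<noteq> 0"
    using pos by (metis less_irrefl)+
  ultimately have "ln (l i * r j) = ln (l' i * r' j)"
    using nz by (simp add: c u_def v_def ln_mult)
  then show ?thesis
    using pos by (subst (asm) ln_inj_iff) auto
qed

text \<open>A choice is needed: multiplying \<open>l\<close> and dividing \<open>r\<close> by the
  same positive constant keeps the matrix balanced.\<close>

definition balancing :: "real ^ 'n ^ 'm \<Rightarrow> ('m \<Rightarrow> real) \<times> ('n \<Rightarrow> real)"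
  where "balancing M = (SOME (l, r). balances M l r)"

definition norms :: "'a::real_normed_vector ^ 'n ^ 'm \<Rightarrow> real ^ 'n ^ 'm"
  where "norms A = (\<chi> i j. norm (A $ i $ j))"

definition left_factor :: "'a::real_normed_vector ^ 'n ^ 'm \<Rightarrow> 'm \<Rightarrow> real"
  where "left_factor A = fst (balancing (norms A))"

definition right_factor :: "'a::real_normed_vector ^ 'n ^ 'm \<Rightarrow> 'n \<Rightarrow> real"
  where "right_factor A = snd (balancing (norms A))"

lemma balances_factors: "balances (norms A) (left_factor A) (right_factor A)"
proof -
  obtain l r where "balances (norms A) l r"
    using balances_exists[of "norms A"] by (auto simp: norms_def)
  then have "case (l, r) of (l, r) \<Rightarrow> balances (norms A) l r"
    by simp
  then have "case balancing (norms A) of (l, r) \<Rightarrow> balances (norms A) l r"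
    unfolding balancing_def by (rule someI)
  then show ?thesis
    by (simp add: left_factor_def right_factor_def case_prod_beta)
qed

lemma factors_pos: "0 < left_factor A i" "0 < right_factor A j"
  using balances_factors[of A] by (auto simp: balances_def)

text \<open>Stated for scaled entries, since uniqueness of \<open>l i * r j\<close> is available
  only where the entry is nonzero.\<close>

lemma scaling_unique:
  fixes A :: "'a::real_normed_vector ^ 'n ^ 'm"
  assumes "balances (norms A) l r"
  shows "(l i * r j) *\<^sub>R A $ i $ j = (left_factor A i * right_factor A j) *\<^sub>R A $ i $ j"
proof (cases "A $ i $ j = 0")
  case False
  have "l i * r j = left_factor A i * right_factor A j"
    by (rule balances_unique[OF _ assms balances_factors]) (use False in \<open>auto simp: norms_def\<close>)
  then show ?thesis
    by simp
qed simp

section \<open>Diagonal matrices\<close>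

definition diag :: "('n \<Rightarrow> 'a::zero) \<Rightarrow> 'a ^ 'n ^ 'n"
  where "diag f = (\<chi> i j. if i = j then f i else 0)"

lemma diag_nth: "diag f $ i $ j = (if i = j then f i else 0)"
  by (simp add: diag_def)

lemma diag_mult_nth: "(diag f ** A) $ i $ j = f i * A $ i $ j" for A :: "'a::semiring_1 ^ 'n ^ 'm"
  by (simp add: diag_def matrix_matrix_mult_def if_distrib if_distribR cong: if_cong)

lemma mult_diag_nth: "(A ** diag f) $ i $ j = A $ i $ j * f j" for A :: "'a::semiring_1 ^ 'n ^ 'm"
  by (simp add: diag_def matrix_matrix_mult_def if_distrib if_distribR cong: if_cong)

lemma diag_mult_diag: "diag f ** diag g = diag (\<lambda>i. f i * g i :: 'a::semiring_1)"
  by (simp add: vec_eq_iff diag_mult_nth) (simp add: diag_nth)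

lemma diag_one: "diag (\<lambda>_. 1) = mat 1"
  by (simp add: diag_def mat_def)

lemma diagonal_matrix_eq_diag: "diagonal_matrix D \<Longrightarrow> D = diag (\<lambda>i. D $ i $ i)"
  by (auto simp: diagonal_matrix_def diag_def vec_eq_iff)

lemma conj_transpose_diag: "conj_transpose (diag f) = diag (\<lambda>i. kconj (f i))"
  by (auto simp: conj_transpose_def diag_def vec_eq_iff)

lemma invertible_diagonal_nonzero:
  assumes "diagonal_matrix D" "invertible D"
  shows "D $ i $ i \<noteq> (0 :: 'a::semiring_1)"
proof
  assume "D $ i $ i = 0"
  obtain B where "D ** B = mat 1"
    using assms(2) by (auto simp: invertible_def)
  moreover have "(D ** B) $ i $ i = D $ i $ i * B $ i $ i"
    by (subst diagonal_matrix_eq_diag[OF assms(1)]) (rule diag_mult_nth)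
  ultimately show False
    using \<open>D $ i $ i = 0\<close> by (simp add: mat_def)
qed

lemma matrix_inv_eqI:
  assumes "A ** B = mat 1" "B ** A = mat 1"
  shows "matrix_inv A = B"
proof -
  have "A ** matrix_inv A = mat 1 \<and> matrix_inv A ** A = mat 1"
    unfolding matrix_inv_def using assms by (intro someI) auto
  then show ?thesis
    by (metis assms(2) matrix_mul_assoc matrix_mul_lid matrix_mul_rid)
qed

abbreviation real_diag :: "('n \<Rightarrow> real) \<Rightarrow> 'a::real_algebra_1 ^ 'n ^ 'n"
  where "real_diag f \<equiv> diag (\<lambda>i. of_real (f i))"

lemma positive_diagonal_iff: "positive_diagonal D \<longleftrightarrow> (\<exists>d. (\<forall>i. 0 < d i) \<and> D = real_diag d)"
proof
  assume D: "positive_diagonal D"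
  then obtain d where "\<And>i. 0 < d i \<and> D $ i $ i = of_real (d i)"
    unfolding positive_diagonal_def by metis
  with D show "\<exists>d. (\<forall>i. 0 < d i) \<and> D = real_diag d"
    by (intro exI[of _ d]) (auto simp: positive_diagonal_def diagonal_matrix_def diag_def vec_eq_iff)
qed (auto simp: positive_diagonal_def diagonal_matrix_def diag_def)

lemma unitary_diagonal_iff: "unitary_diagonal D \<longleftrightarrow> (\<exists>d. (\<forall>i. norm (d i) = 1) \<and> D = diag d)"
proof
  assume D: "unitary_diagonal D"
  then show "\<exists>d. (\<forall>i. norm (d i) = 1) \<and> D = diag d"
    by (intro exI[of _ "\<lambda>i. D $ i $ i"]) (simp add: unitary_diagonal_def diagonal_matrix_eq_diag)
qed (auto simp: unitary_diagonal_def diagonal_matrix_def diag_def)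

lemma real_diag_scale_nth:
  "(real_diag d ** A ** real_diag e) $ i $ j = (d i * e j) *\<^sub>R A $ i $ j"
  by (simp add: diag_mult_nth mult_diag_nth of_real_def mult.commute)

section \<open>Scale functions\<close>

definition scaled :: "'a::real_normed_algebra_1 ^ 'n ^ 'm \<Rightarrow> 'a ^ 'n ^ 'm"
  where "scaled A = real_diag (left_factor A) ** A ** real_diag (right_factor A)"

lemma scaled_eqI:
  assumes "balances (norms A) l r"
  shows "real_diag l ** A ** real_diag r = scaled A"
  unfolding scaled_def using scaling_unique[OF assms] by (simp add: vec_eq_iff real_diag_scale_nth)

text \<open>Factors balancing \<open>B\<close>, multiplied by \<open>d\<close> and \<open>e\<close>,
  balance \<open>A\<close>; uniqueness of the scaled matrix does the rest.\<close>

lemma scaled_diagonal: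
  fixes A :: "'a::conj_div_algebra ^ 'n ^ 'm"
  assumes "\<And>i. 0 < d i" "\<And>j. 0 < e j"
  defines "B \<equiv> real_diag d ** A ** real_diag e"
  shows "scaled B = scaled A"
proof -
  have norms: "norms B $ i $ j = d i * norms A $ i $ j * e j" for i j
    using assms(1)[of i] assms(2)[of j] by (simp add: B_def norms_def real_diag_scale_nth)
  have "balances (norms A) (\<lambda>i. left_factor B i * d i) (\<lambda>j. e j * right_factor B j)"
    using balances_factors[of B] assms(1,2) by (simp add: balances_def norms mult.assoc)
  then have "scaled A = real_diag (\<lambda>i. left_factor B i * d i) ** A
      ** real_diag (\<lambda>j. e j * right_factor B j)"
    by (rule scaled_eqI[symmetric])
  also have "\<dots> = scaled B"
    by (simp add: scaled_def B_def matrix_mul_assoc flip: diag_mult_diag)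
  finally show ?thesis ..
qed

lemma factors_unitary:
  fixes A :: "'a::conj_div_algebra ^ 'n ^ 'm"
  assumes "unitary_diagonal D" "unitary_diagonal E"
  shows "left_factor (D ** A ** E) = left_factor A" "right_factor (D ** A ** E) = right_factor A"
proof -
  obtain d e where "\<And>i. norm (d i) = 1" "D = diag d" "\<And>i. norm (e i) = 1" "E = diag e"
    using assms by (auto simp: unitary_diagonal_iff)
  then have "norms (D ** A ** E) = norms A"
    by (simp add: norms_def diag_mult_nth mult_diag_nth norm_mult)
  then show "left_factor (D ** A ** E) = left_factor A"
    "right_factor (D ** A ** E) = right_factor A"
    by (simp_all add: left_factor_def right_factor_def)
qed

lemma permutation_mult_nth:
  fixes A :: "'a::semiring_1 ^ 'n ^ 'm"
  assumes "bij q"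
  shows "((\<chi> i j. if j = p i then 1 else 0) ** A ** (\<chi> i j. if j = q i then 1 else 0)) $ i $ j
    = A $ p i $ inv q j"
proof -
  have "j = q k \<longleftrightarrow> k = inv q j" for k
    using assms by (metis bij_inv_eq_iff)
  then show ?thesis
    by (simp add: matrix_matrix_mult_def if_distrib if_distribR cong: if_cong)
qed

text \<open>Permuted factors balance the permuted matrix, because its row and column sums are
  reindexings of those of \<open>A\<close>.\<close>

lemma scaled_permutation:
  fixes A :: "'a::conj_div_algebra ^ 'n ^ 'm"
  assumes "permutation_matrix P" "permutation_matrix Q"
  shows "scaled (P ** A ** Q) = P ** scaled A ** Q"
proof -
  obtain p q where p: "bij p" "P = (\<chi> i j. if j = p i then 1 else 0)"
    and q: "bij q" "Q = (\<chi> i j. if j = q i then 1 else 0)"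
    using assms by (auto simp: permutation_matrix_def)
  define B where "B = P ** A ** Q"
  have nth: "(P ** C ** Q) $ i $ j = C $ p i $ inv q j" for C :: "'a ^ 'n ^ 'm" and i j
    unfolding p(2) q(2) by (rule permutation_mult_nth[OF q(1)])
  have "balances (norms B) (\<lambda>i. left_factor A (p i)) (\<lambda>j. right_factor A (inv q j))"
  proof -
    define f where "f i j = ln (left_factor A i * norms A $ i $ j * right_factor A j)" for i j
    have f: "ln (left_factor A (p i) * norms B $ i $ j * right_factor A (inv q j)) = f (p i) (inv q j)"
      for i j
      by (simp add: f_def norms_def B_def nth)
    have "(\<Sum>j\<in>UNIV. f i (inv q j)) = (\<Sum>j\<in>UNIV. f i j)" for i
      by (rule sum.reindex_bij_betw[OF bij_imp_bij_inv[OF q(1)]])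
    moreover have "(\<Sum>i\<in>UNIV. f (p i) j) = (\<Sum>i\<in>UNIV. f i j)" for j
      by (rule sum.reindex_bij_betw[OF p(1)])
    ultimately show ?thesis
      using balances_factors[of A] by (simp add: balances_def f) (simp add: f_def)
  qed
  then have "scaled B = real_diag (\<lambda>i. left_factor A (p i)) ** B
      ** real_diag (\<lambda>j. right_factor A (inv q j))"
    by (rule scaled_eqI[symmetric])
  then show ?thesis
    by (simp add: vec_eq_iff real_diag_scale_nth nth flip: B_def)
      (simp add: B_def nth scaled_def real_diag_scale_nth)
qed

section \<open>The scale functions and their axioms\<close>

definition left_scale :: "'a::real_normed_algebra_1 ^ 'n ^ 'm \<Rightarrow> 'a ^ 'm ^ 'm"
  where "left_scale A = real_diag (left_factor A)"

definition right_scale :: "'a::real_normed_algebra_1 ^ 'n ^ 'm \<Rightarrow> 'a ^ 'n ^ 'n"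
  where "right_scale A = real_diag (right_factor A)"

lemma general_diagonal_scale_functions_scale:
  "general_diagonal_scale_functions
    (left_scale :: 'a::conj_div_algebra ^ 'n ^ 'm \<Rightarrow> 'a ^ 'm ^ 'm) right_scale"
proof -
  have scaled: "left_scale A ** A ** right_scale A = scaled A" for A :: "'a ^ 'n ^ 'm"
    by (simp add: left_scale_def right_scale_def scaled_def)
  have "positive_diagonal (left_scale A)" "positive_diagonal (right_scale A)"
    for A :: "'a ^ 'n ^ 'm"
    unfolding left_scale_def right_scale_def positive_diagonal_iff using factors_pos by blast+
  moreover have "scaled (D ** A ** E) = scaled A"
    if "positive_diagonal D" "positive_diagonal E" for A :: "'a ^ 'n ^ 'm" and D E
    using that scaled_diagonal unfolding positive_diagonal_iff by blast
  ultimately show ?thesis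
    unfolding general_diagonal_scale_functions_def scaled
    by (simp add: scaled_permutation factors_unitary left_scale_def right_scale_def)
qed

section \<open>The unit-consistent inverse\<close>

lemma conj_transpose_unitary_diagonal:
  assumes "unitary_diagonal D"
  shows "conj_transpose D ** D = mat 1" "D ** conj_transpose D = mat 1"
  using assms by (auto simp: unitary_diagonal_iff conj_transpose_diag diag_mult_diag
      kconj_mult_self mult_kconj diag_one)

lemma positive_diagonal_inverse:
  fixes D :: "'a::real_div_algebra ^ 'n ^ 'n"
  assumes "positive_diagonal D"
  obtains D' where "positive_diagonal D'" "D ** D' = mat 1" "D' ** D = mat 1"
proof -
  obtain d where d: "\<And>i. 0 < d i" "D = real_diag d"
    using assms by (auto simp: positive_diagonal_iff)
  then have "d i \<noteq> 0" for i
    by (metis less_irrefl)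
  moreover have "positive_diagonal (real_diag (\<lambda>i. inverse (d i)) :: 'a ^ 'n ^ 'n)"
    unfolding positive_diagonal_iff using d by (intro exI[of _ "\<lambda>i. inverse (d i)"]) simp
  ultimately show ?thesis
    using d by (intro that) (auto simp: diag_mult_diag diag_one simp flip: of_real_mult)
qed

lemma conj_transpose_positive_diagonal: "positive_diagonal D \<Longrightarrow> conj_transpose D = D"
  by (auto simp: positive_diagonal_iff conj_transpose_diag)

lemma positive_diagonal_mult:
  assumes "positive_diagonal D" "positive_diagonal E"
  shows "positive_diagonal (D ** E)"
proof -
  obtain d e where de: "\<And>i. 0 < d i" "D = real_diag d" "\<And>i. 0 < e i" "E = real_diag e"
    using assms by (auto simp: positive_diagonal_iff)
  then show ?thesis
    unfolding positive_diagonal_iff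
    by (intro exI[of _ "\<lambda>i. d i * e i"]) (simp add: diag_mult_diag)
qed

lemma diagonal_polar_decomposition:
  fixes D :: "'a::conj_div_algebra ^ 'n ^ 'n"
  assumes "diagonal_matrix D" "invertible D"
  obtains P U where "positive_diagonal P" "unitary_diagonal U" "D = U ** P"
proof
  define P where "P = (real_diag (\<lambda>i. norm (D $ i $ i)) :: 'a ^ 'n ^ 'n)"
  define U where "U = diag (\<lambda>i. sgn (D $ i $ i))"
  have nz: "D $ i $ i \<noteq> 0" for i
    using invertible_diagonal_nonzero[OF assms] .
  show "positive_diagonal P"
    unfolding positive_diagonal_iff P_def
    using nz by (intro exI[of _ "\<lambda>i. norm (D $ i $ i)"]) simp
  show "unitary_diagonal U"
    unfolding unitary_diagonal_iff U_def
    using nz by (intro exI[of _ "\<lambda>i. sgn (D $ i $ i)"]) (simp add: norm_sgn)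
  have "sgn x * of_real (norm x) = x" for x :: 'a
    by (cases "x = 0") (simp_all add: sgn_div_norm of_real_def)
  then show "D = U ** P"
    unfolding U_def P_def diag_mult_diag
    by (subst diagonal_matrix_eq_diag[OF assms(1)]) simp
qed

text \<open>Real scalars are central, also in the quaternions.\<close>

lemma positive_diagonal_commute:
  fixes D :: "'a::real_algebra_1 ^ 'n ^ 'n"
  assumes "positive_diagonal P" "diagonal_matrix D"
  shows "P ** D = D ** P"
proof -
  obtain p where "P = real_diag p"
    using assms(1) by (auto simp: positive_diagonal_iff)
  then show ?thesis
    by (subst (1 2) diagonal_matrix_eq_diag[OF assms(2)])
      (simp add: diag_mult_diag of_real_def)
qed

text \<open>The positive diagonal factors are invertible, so they cancel from the Moore--Penrose
  identities of the scaled matrix.\<close>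

lemma
  fixes L :: "'a::conj_div_algebra ^ 'n ^ 'm \<Rightarrow> 'a ^ 'm ^ 'm"
  assumes "general_diagonal_scale_functions L R"
  shows unit_inverse_inner: "A ** unit_inverse L R A ** A = A"
    and unit_inverse_outer: "unit_inverse L R A ** A ** unit_inverse L R A = unit_inverse L R A"
proof -
  have "positive_diagonal (L A)" "positive_diagonal (R A)"
    using assms by (auto simp: general_diagonal_scale_functions_def)
  then obtain L' R' where L: "L' ** L A = mat 1" and R: "R A ** R' = mat 1"
    by (metis positive_diagonal_inverse)
  define M where "M = L A ** A ** R A"
  define Y where "Y = moore_penrose M"
  have Y: "M ** Y ** M = M" "Y ** M ** Y = Y"
    using is_moore_penrose_moore_penrose[of M] by (simp_all add: is_moore_penrose_def Y_def)
  have X: "unit_inverse L R A = R A ** Y ** L A"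
    by (simp add: unit_inverse_def M_def Y_def)
  have "L A ** (A ** (R A ** Y ** L A) ** A) ** R A = L A ** A ** R A"
    using Y(1) by (simp add: M_def matrix_mul_assoc)
  then have "L' ** (L A ** (A ** (R A ** Y ** L A) ** A) ** R A) ** R' = L' ** (L A ** A ** R A) ** R'"
    by simp
  then show "A ** unit_inverse L R A ** A = A"
    by (metis L R X matrix_mul_assoc matrix_mul_lid matrix_mul_rid)
  have "R A ** Y ** L A ** A ** (R A ** Y ** L A) = R A ** (Y ** M ** Y) ** L A"
    by (simp add: M_def matrix_mul_assoc)
  then show "unit_inverse L R A ** A ** unit_inverse L R A = unit_inverse L R A"
    by (simp add: X Y)
qed

text \<open>
  The scale functions themselves need not be equivariant: when the bipartite graph of nonzero
  entries is disconnected, the scalings of \<open>D A E\<close> and of \<open>A\<close> may differ by positive diagonal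
  \<open>U\<close> and \<open>V\<close> that fix the scaled matrix, and these also fix its Moore--Penrose inverse.
\<close>

lemma unit_inverse_diagonal:
  fixes L :: "'a::conj_div_algebra ^ 'n ^ 'm \<Rightarrow> 'a ^ 'm ^ 'm"
  assumes scale: "general_diagonal_scale_functions L R"
    and D: "diagonal_matrix D" "invertible D" and E: "diagonal_matrix E" "invertible E"
  shows "unit_inverse L R (D ** A ** E) = matrix_inv E ** unit_inverse L R A ** matrix_inv D"
proof -
  obtain P S where PS: "positive_diagonal P" "unitary_diagonal S" "D = S ** P"
    using diagonal_polar_decomposition[OF D] .
  obtain Q T where QT: "positive_diagonal Q" "unitary_diagonal T" "E = T ** Q"
    using diagonal_polar_decomposition[OF E] .
  have pos: "positive_diagonal (L B)" "positive_diagonal (R B)" for B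
    using scale by (auto simp: general_diagonal_scale_functions_def)
  \<comment> \<open>Reordering puts the unitary parts outermost, so \<open>D ** A ** E\<close> is a
    unitary scaling of \<open>B = P ** A ** Q\<close>.\<close>
  have ET: "E = Q ** T"
    using QT positive_diagonal_commute unfolding unitary_diagonal_def by metis
  define B where "B = P ** A ** Q"
  have DAE: "D ** A ** E = S ** B ** T"
    by (simp add: B_def PS(3) ET matrix_mul_assoc)
  have LR: "L (D ** A ** E) = L B" "R (D ** A ** E) = R B"
    using scale PS QT unfolding general_diagonal_scale_functions_def DAE by blast+
  define M where "M = L A ** A ** R A"
  have M: "M = L B ** B ** R B"
    using scale PS QT unfolding general_diagonal_scale_functions_def M_def B_def by metis
  \<comment> \<open>The scale matrices are real diagonal and commute with the unitary parts, which
    then come out of the scaled matrix.\<close>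
  have LS: "L B ** S = S ** L B" and TR: "T ** R B = R B ** T"
    using pos PS QT positive_diagonal_commute unfolding unitary_diagonal_def by metis+
  have scaled: "L B ** (S ** B ** T) ** R B = S ** M ** T"
    by (simp add: M matrix_mul_assoc LS) (simp add: TR flip: matrix_mul_assoc)
  obtain L' R' where L': "positive_diagonal L'" "L A ** L' = mat 1" "L' ** L A = mat 1"
    and R': "positive_diagonal R'" "R A ** R' = mat 1" "R' ** R A = mat 1"
    using pos positive_diagonal_inverse by metis
  obtain P' where P': "P ** P' = mat 1" "P' ** P = mat 1"
    using PS(1) by (rule positive_diagonal_inverse)
  obtain Q' where Q': "Q ** Q' = mat 1" "Q' ** Q = mat 1"
    using QT(1) by (rule positive_diagonal_inverse)
  \<comment> \<open>\<open>U\<close> and \<open>V\<close> measure how far the factors chosen for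
    \<open>B\<close> differ from those for \<open>A\<close> corrected by \<open>P\<close> and
    \<open>Q\<close>; they fix \<open>M\<close>, as both scalings yield it.\<close>
  define U where "U = L B ** P ** L'"
  define V where "V = R' ** Q ** R B"
  have "U ** M ** V = M"
  proof -
    have "U ** M ** V = L B ** P ** (L' ** L A) ** A ** (R A ** R') ** Q ** R B"
      by (simp add: U_def V_def M_def matrix_mul_assoc)
    also have "\<dots> = M"
      by (simp add: L' R' M B_def matrix_mul_assoc)
    finally show ?thesis .
  qed
  moreover have posUV: "positive_diagonal U" "positive_diagonal V"
    unfolding U_def V_def by (intro positive_diagonal_mult pos PS(1) QT(1) L'(1) R'(1))+
  ultimately have stab: "V ** moore_penrose M ** U = moore_penrose M"
    by (metis moore_penrose_stabilizer conj_transpose_positive_diagonal positive_diagonal_inverse)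
  have S: "conj_transpose S ** S = mat 1" "S ** conj_transpose S = mat 1"
    and T: "conj_transpose T ** T = mat 1" "T ** conj_transpose T = mat 1"
    using conj_transpose_unitary_diagonal PS(2) QT(2) by blast+
  have invD: "matrix_inv D = P' ** conj_transpose S"
    by (rule matrix_inv_eqI) (metis PS(3) P' S matrix_mul_assoc matrix_mul_rid)+
  have invE: "matrix_inv E = conj_transpose T ** Q'"
    by (rule matrix_inv_eqI) (metis ET Q' T matrix_mul_assoc matrix_mul_rid)+
  have RTc: "R B ** conj_transpose T = conj_transpose T ** R B"
    using arg_cong[OF TR, of conj_transpose] pos
    by (simp add: conj_transpose_mult conj_transpose_positive_diagonal)
  have LSc: "conj_transpose S ** L B = L B ** conj_transpose S"
    using arg_cong[OF LS, of conj_transpose] pos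
    by (simp add: conj_transpose_mult conj_transpose_positive_diagonal)
  \<comment> \<open>Solving the definitions of \<open>V\<close> and \<open>U\<close> for the factors
    of \<open>B\<close> places \<open>V\<close> and \<open>U\<close> next to
    \<open>moore_penrose M\<close>, where \<open>stab\<close> removes them.\<close>
  have RB: "R B = Q' ** R A ** V"
    by (metis V_def R'(2) Q'(2) matrix_mul_assoc matrix_mul_lid)
  have LB: "L B = U ** L A ** P'"
    by (metis U_def L'(3) P'(1) matrix_mul_assoc matrix_mul_rid)
  have "unit_inverse L R (D ** A ** E)
      = R B ** moore_penrose (L B ** (S ** B ** T) ** R B) ** L B"
    by (simp add: unit_inverse_def LR) (simp add: DAE)
  also have "\<dots> = R B ** conj_transpose T ** moore_penrose M ** (conj_transpose S ** L B)"
    unfolding scaled by (simp add: moore_penrose_unitary S T matrix_mul_assoc)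
  also have "\<dots> = conj_transpose T ** (Q' ** R A ** V) ** moore_penrose M
      ** (U ** L A ** P' ** conj_transpose S)"
    unfolding RTc LSc using RB LB by simp
  also have "\<dots> = conj_transpose T ** Q' ** R A ** (V ** moore_penrose M ** U)
      ** L A ** P' ** conj_transpose S"
    by (simp add: matrix_mul_assoc)
  also have "\<dots> = matrix_inv E ** unit_inverse L R A ** matrix_inv D"
    unfolding stab by (simp add: invD invE unit_inverse_def M_def matrix_mul_assoc)
  finally show ?thesis .
qed

text \<open>By the inner and outer identities each of the two matrices is a product with the other
  as middle factor, so each rank bounds the other.\<close>

lemma skew_rank_unit_inverse:
  fixes L :: "'a::conj_div_algebra ^ 'n ^ 'm \<Rightarrow> 'a ^ 'm ^ 'm"
  assumes "general_diagonal_scale_functions L R"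
  shows "skew_rank (unit_inverse L R A) = skew_rank A"
  using skew_rank_mult_le[of A "unit_inverse L R A" A]
    skew_rank_mult_le[of "unit_inverse L R A" A "unit_inverse L R A"]
  by (simp add: unit_inverse_inner[OF assms] unit_inverse_outer[OF assms])

lemma rank_unit_inverse:
  fixes L :: "'a::{conj_div_algebra, field} ^ 'n ^ 'm \<Rightarrow> 'a ^ 'm ^ 'm"
  assumes "general_diagonal_scale_functions L R"
  shows "rank (unit_inverse L R A) = rank A"
  using skew_rank_unit_inverse[OF assms] by (simp only: skew_rank_eq_rank)

theorem theoremV4:
  shows
   "(\<exists>(L :: real ^ 'n ^ 'm \<Rightarrow> real ^ 'm ^ 'm) (R :: real ^ 'n ^ 'm \<Rightarrow> real ^ 'n ^ 'n).
      general_diagonal_scale_functions L R \<and>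
      (\<forall>A D E. diagonal_matrix D \<and> invertible D \<and> diagonal_matrix E \<and> invertible E \<longrightarrow>
        A ** unit_inverse L R A ** A = A \<and>
        unit_inverse L R A ** A ** unit_inverse L R A = unit_inverse L R A \<and>
        unit_inverse L R (D ** A ** E) = matrix_inv E ** unit_inverse L R A ** matrix_inv D \<and>
        rank (unit_inverse L R A) = rank A)) \<and>
    (\<exists>(L :: complex ^ 'n ^ 'm \<Rightarrow> complex ^ 'm ^ 'm) (R :: complex ^ 'n ^ 'm \<Rightarrow> complex ^ 'n ^ 'n).
      general_diagonal_scale_functions L R \<and>
      (\<forall>A D E. diagonal_matrix D \<and> invertible D \<and> diagonal_matrix E \<and> invertible E \<longrightarrow>
        A ** unit_inverse L R A ** A = A \<and>
        unit_inverse L R A ** A ** unit_inverse L R A = unit_inverse L R A \<and>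
        unit_inverse L R (D ** A ** E) = matrix_inv E ** unit_inverse L R A ** matrix_inv D \<and>
        rank (unit_inverse L R A) = rank A)) \<and>
    (\<exists>(L :: quat ^ 'n ^ 'm \<Rightarrow> quat ^ 'm ^ 'm) (R :: quat ^ 'n ^ 'm \<Rightarrow> quat ^ 'n ^ 'n).
      general_diagonal_scale_functions L R \<and>
      (\<forall>A D E. diagonal_matrix D \<and> invertible D \<and> diagonal_matrix E \<and> invertible E \<longrightarrow>
        A ** unit_inverse L R A ** A = A \<and>
        unit_inverse L R A ** A ** unit_inverse L R A = unit_inverse L R A \<and>
        unit_inverse L R (D ** A ** E) = matrix_inv E ** unit_inverse L R A ** matrix_inv D \<and>
        skew_rank (unit_inverse L R A) = skew_rank A))"
  by (intro conjI exI[where x = left_scale] exI[where x = right_scale] allI impI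
      general_diagonal_scale_functions_scale
      unit_inverse_inner unit_inverse_outer unit_inverse_diagonal
      rank_unit_inverse skew_rank_unit_inverse) auto

end
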